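(* Let $\mathbb{X}$ be a symmetric monoidal category with a monoidal bialgebra modality $(!,\delta,\varepsilon,\Delta,\mathsf{e},\mathsf{m},\mathsf{m}_I,\nabla,\mathsf{u})$ which comes equipped with a pre-codereliction $\eta$. Then $\mathbb{X}$ is an additive symmetric monoidal category where: (i) for parallel maps $f,g: A\to B$, their sum is $$f+g := \eta_A;\Delta_A;(!(f)\otimes !(g));\nabla_B;\varepsilon_B : A\to B;$$ (ii) the zero map is $$0 := \eta_A;\mathsf{e}_A;\mathsf{u}_B;\varepsilon_B : A\to B.$$
   Context: Conventions: composition is written diagrammatically, $f;g$ means first $f$ then $g$. Symmetric monoidal categories are taken to be strict, with product $\otimes$, unit $I$, symmetry $\sigma_{A,B}:A\otimes B\to B\otimes A$. Additive category: each homset is a commutative monoid $(+,0)$ with $f;(g+h)=f;g+f;h$, $f;0=0$, $(g+h);k=g;k+h;k$, $0;k=0$ (enrichment over commutative monoids; biproducts are not assumed). Additive symmetric monoidal category: a symmetric monoidal category that is additive and satisfies $f\otimes(g+h)=f\otimes g+f\otimes h$, $f\otimes 0=0$, $(g+h)\otimes k=g\otimes k+h\otimes k$, $0\otimes k=0$. Coalgebra modality $(!,\delta,\varepsilon,\Delta,\mathsf{e})$: a comonad $(!,\delta,\varepsilon)$, with $\delta_A:!(A)\to!!(A)$, $\varepsilon_A:!(A)\to A$, together with natural transformations $\Delta_A:!(A)\to!(A)\otimes!(A)$, $\mathsf{e}_A:!(A)\to I$ such that each $(!(A),\Delta_A,\mathsf{e}_A)$ is a cocommutative comonoid and $\delta_A$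 is a comonoid morphism: $\delta_A;\Delta_{!(A)}=\Delta_A;(\delta_A\otimes\delta_A)$, $\delta_A;\mathsf{e}_{!(A)}=\mathsf{e}_A$. Monoidal coalgebra modality $(!,\delta,\varepsilon,\Delta,\mathsf{e},\mathsf{m},\mathsf{m}_I)$: a coalgebra modality with a natural transformation $\mathsf{m}_{A,B}:!(A)\otimes!(B)\to!(A\otimes B)$ and a map $\mathsf{m}_I:I\to!(I)$ making $!$ a symmetric (lax) monoidal endofunctor, such that - $\mathsf{m}_{A,B};\delta_{A\otimes B}=(\delta_A\otimes\delta_B);\mathsf{m}_{!(A),!(B)};!(\mathsf{m}_{A,B})$, $\mathsf{m}_I;\delta_I=\mathsf{m}_I;!(\mathsf{m}_I)$, $\mathsf{m}_{A,B};\varepsilon_{A\otimes B}=\varepsilon_A\otimes\varepsilon_B$, $\mathsf{m}_I;\varepsilon_I=1_I$; - $\mathsf{m}_{A,B};\Delta_{A\otimes B}=(\Delta_A\otimes\Delta_B);(1\otimes\sigma_{!(A),!(B)}\otimes1);(\mathsf{m}_{A,B}\otimes\mathsf{m}_{A,B})$, $\mathsf{m}_{A,B};\mathsf{e}_{A\otimes B}=\mathsf{e}_A\otimes\mathsf{e}_B$, $\mathsf{m}_I;\Delta_I=\mathsf{m}_I\otimes\mathsf{m}_I$, $\mathsf{m}_I;\mathsf{e}_I=1_I$; - $\delta_A;!(\Delta_A)=\Delta_A;(\delta_A\otimes\delta_A);\mathsf{m}_{!(A),!(A)}$, $\delta_A;!(\mathsf{e}_A)=\mathsf{e}_A;\mathsf{m}_I$.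 Bialgebra modality $(!,\delta,\varepsilon,\Delta,\mathsf{e},\nabla,\mathsf{u})$: a coalgebra modality with natural transformations $\nabla_A:!(A)\otimes!(A)\to!(A)$, $\mathsf{u}_A:I\to!(A)$ such that each $(!(A),\nabla_A,\mathsf{u}_A)$ is a commutative monoid and $(!(A),\nabla_A,\mathsf{u}_A,\Delta_A,\mathsf{e}_A)$ is a bimonoid. Monoidal bialgebra modality $(!,\delta,\varepsilon,\Delta,\mathsf{e},\mathsf{m},\mathsf{m}_I,\nabla,\mathsf{u})$: both a monoidal coalgebra modality and a bialgebra modality (on the same coalgebra modality) such that - $(1_{!(A)}\otimes\nabla_B);\mathsf{m}_{A,B}=(\Delta_A\otimes1\otimes1);(1\otimes\sigma_{!(A),!(B)}\otimes1);(\mathsf{m}_{A,B}\otimes\mathsf{m}_{A,B});\nabla_{A\otimes B}$; - $(\nabla_A\otimes1_{!(B)});\mathsf{m}_{A,B}=(1\otimes1\otimes\Delta_B);(1\otimes\sigma_{!(A),!(B)}\otimes1);(\mathsf{m}_{A,B}\otimes\mathsf{m}_{A,B});\nabla_{A\otimes B}$; - $(\mathsf{u}_A\otimes1_{!(B)});\mathsf{m}_{A,B}=\mathsf{e}_B;\mathsf{u}_{A\otimes B}$, $(1_{!(A)}\otimes\mathsf{u}_B);\mathsf{m}_{A,B}=\mathsf{e}_A;\mathsf{u}_{A\otimes B}$; - $\nabla_A;\delta_A=(\delta_A\otimes\delta_A);\mathsf{m}_{!(A),!(A)};!(\nabla_A)$, $\mathsf{u}_A;\delta_A=\mathsf{m}_I;!(\mathsf{u}_A)$.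 Pre-codereliction for a monoidal coalgebra modality: a natural transformation $\eta_A:A\to!(A)$ such that $\eta_A;\varepsilon_A=1_A$, $(\eta_A\otimes1_{!(B)});\mathsf{m}_{A,B}=(1_A\otimes\varepsilon_B);\eta_{A\otimes B}$, and $(1_{!(A)}\otimes\eta_B);\mathsf{m}_{A,B}=(\varepsilon_A\otimes1_B);\eta_{A\otimes B}$. A pre-codereliction for a monoidal bialgebra modality is one for its underlying monoidal coalgebra modality. *)

theory Defs
  imports "HOL-Algebra.Group"
begin

text \<open>
  Composition is diagrammatic: \<open>f \<Zsemi> g\<close> is first \<open>f\<close>, then \<open>g\<close>. A category has a set of objects
  and a set of arrows, with source and target functions; the operations are only constrained on
  these sets.
\<close>

record ('o, 'm) category =
  obj :: "'o set"
  arr :: "'m set"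
  src :: "'m \<Rightarrow> 'o"
  tgt :: "'m \<Rightarrow> 'o"
  ident :: "'o \<Rightarrow> 'm" ("\<iota>\<index>")
  comp :: "'m \<Rightarrow> 'm \<Rightarrow> 'm" (infixl "\<Zsemi>\<index>" 55)

definition homset :: "('o, 'm, 'x) category_scheme \<Rightarrow> 'o \<Rightarrow> 'o \<Rightarrow> 'm set" where
  "homset C A B = {f \<in> arr C. src C f = A \<and> tgt C f = B}"

locale category =
  fixes C :: "('o, 'm, 'x) category_scheme" (structure)
  assumes src_obj: "f \<in> arr C \<Longrightarrow> src C f \<in> obj C"
    and tgt_obj: "f \<in> arr C \<Longrightarrow> tgt C f \<in> obj C"
    and ident_hom: "A \<in> obj C \<Longrightarrow> \<iota> A \<in> homset C A A"
    and comp_hom: "\<lbrakk>f \<in> homset C A B; g \<in> homset C B D\<rbrakk> \<Longrightarrow> f \<Zsemi> g \<in> homset C A D"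
    and comp_assoc: "\<lbrakk>f \<in> homset C A B; g \<in> homset C B D; h \<in> homset C D E\<rbrakk>
          \<Longrightarrow> (f \<Zsemi> g) \<Zsemi> h = f \<Zsemi> (g \<Zsemi> h)"
    and ident_left: "f \<in> homset C A B \<Longrightarrow> \<iota> A \<Zsemi> f = f"
    and ident_right: "f \<in> homset C A B \<Longrightarrow> f \<Zsemi> \<iota> B = f"

record ('o, 'm) smc = "('o, 'm) category" +
  tensor_obj :: "'o \<Rightarrow> 'o \<Rightarrow> 'o" (infixl "\<otimes>\<^sub>o\<index>" 70)
  tensor_arr :: "'m \<Rightarrow> 'm \<Rightarrow> 'm" (infixl "\<otimes>\<^sub>m\<index>" 70)
  unit_obj :: 'o ("\<I>\<index>")
  sym :: "'o \<Rightarrow> 'o \<Rightarrow> 'm" ("\<sigma>\<index>")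

text \<open>
  Strictness means that the associators and unitors are identities, so the coherence laws reduce to
  the ones below.
\<close>

locale strict_symmetric_monoidal_category = category C
  for C :: "('o, 'm, 'x) smc_scheme" (structure) +
  assumes unit_obj: "\<I> \<in> obj C"
    and tensor_obj: "\<lbrakk>A \<in> obj C; B \<in> obj C\<rbrakk> \<Longrightarrow> A \<otimes>\<^sub>o B \<in> obj C"
    and tensor_hom: "\<lbrakk>f \<in> homset C A A'; g \<in> homset C B B'\<rbrakk>
          \<Longrightarrow> f \<otimes>\<^sub>m g \<in> homset C (A \<otimes>\<^sub>o B) (A' \<otimes>\<^sub>o B')"
    and tensor_ident: "\<lbrakk>A \<in> obj C; B \<in> obj C\<rbrakk> \<Longrightarrow> \<iota> A \<otimes>\<^sub>m \<iota> B = \<iota> (A \<otimes>\<^sub>o B)"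
    and tensor_comp: "\<lbrakk>f \<in> homset C A A'; f' \<in> homset C A' A''; g \<in> homset C B B'; g' \<in> homset C B' B''\<rbrakk>
          \<Longrightarrow> (f \<Zsemi> f') \<otimes>\<^sub>m (g \<Zsemi> g') = (f \<otimes>\<^sub>m g) \<Zsemi> (f' \<otimes>\<^sub>m g')"
    and tensor_obj_assoc: "\<lbrakk>A \<in> obj C; B \<in> obj C; D \<in> obj C\<rbrakk>
          \<Longrightarrow> (A \<otimes>\<^sub>o B) \<otimes>\<^sub>o D = A \<otimes>\<^sub>o (B \<otimes>\<^sub>o D)"
    and tensor_obj_unit_left: "A \<in> obj C \<Longrightarrow> \<I> \<otimes>\<^sub>o A = A"
    and tensor_obj_unit_right: "A \<in> obj C \<Longrightarrow> A \<otimes>\<^sub>o \<I> = A"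
    and tensor_arr_assoc: "\<lbrakk>f \<in> arr C; g \<in> arr C; h \<in> arr C\<rbrakk>
          \<Longrightarrow> (f \<otimes>\<^sub>m g) \<otimes>\<^sub>m h = f \<otimes>\<^sub>m (g \<otimes>\<^sub>m h)"
    and tensor_arr_unit_left: "f \<in> arr C \<Longrightarrow> \<iota> \<I> \<otimes>\<^sub>m f = f"
    and tensor_arr_unit_right: "f \<in> arr C \<Longrightarrow> f \<otimes>\<^sub>m \<iota> \<I> = f"
    and sym_hom: "\<lbrakk>A \<in> obj C; B \<in> obj C\<rbrakk> \<Longrightarrow> \<sigma> A B \<in> homset C (A \<otimes>\<^sub>o B) (B \<otimes>\<^sub>o A)"
    and sym_natural: "\<lbrakk>f \<in> homset C A A'; g \<in> homset C B B'\<rbrakk>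
          \<Longrightarrow> (f \<otimes>\<^sub>m g) \<Zsemi> \<sigma> A' B' = \<sigma> A B \<Zsemi> (g \<otimes>\<^sub>m f)"
    and sym_sym: "\<lbrakk>A \<in> obj C; B \<in> obj C\<rbrakk> \<Longrightarrow> \<sigma> A B \<Zsemi> \<sigma> B A = \<iota> (A \<otimes>\<^sub>o B)"
    and sym_unit: "A \<in> obj C \<Longrightarrow> \<sigma> A \<I> = \<iota> A"
    and sym_hexagon: "\<lbrakk>A \<in> obj C; B \<in> obj C; D \<in> obj C\<rbrakk>
          \<Longrightarrow> \<sigma> A (B \<otimes>\<^sub>o D) = (\<sigma> A B \<otimes>\<^sub>m \<iota> D) \<Zsemi> (\<iota> B \<otimes>\<^sub>m \<sigma> A D)"

text \<open>
  Additive categories are enriched over commutative monoids; neither negatives nor biproducts are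
  required. The structure on the homset from \<open>A\<close> to \<open>B\<close> is \<open>plus A B\<close> and \<open>zero A B\<close>.
\<close>

locale additive_category = category C
  for C :: "('o, 'm, 'x) category_scheme" (structure) +
  fixes plus :: "'o \<Rightarrow> 'o \<Rightarrow> 'm \<Rightarrow> 'm \<Rightarrow> 'm"
    and zero :: "'o \<Rightarrow> 'o \<Rightarrow> 'm"
  assumes hom_comm_monoid: "\<lbrakk>A \<in> obj C; B \<in> obj C\<rbrakk>
          \<Longrightarrow> comm_monoid \<lparr>carrier = homset C A B, monoid.mult = plus A B, one = zero A B\<rparr>"
    and comp_plus: "\<lbrakk>f \<in> homset C A B; g \<in> homset C B D; h \<in> homset C B D\<rbrakk>
          \<Longrightarrow> f \<Zsemi> plus B D g h = plus A D (f \<Zsemi> g) (f \<Zsemi> h)"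
    and comp_zero: "\<lbrakk>f \<in> homset C A B; D \<in> obj C\<rbrakk> \<Longrightarrow> f \<Zsemi> zero B D = zero A D"
    and plus_comp: "\<lbrakk>g \<in> homset C A B; h \<in> homset C A B; k \<in> homset C B D\<rbrakk>
          \<Longrightarrow> plus A B g h \<Zsemi> k = plus A D (g \<Zsemi> k) (h \<Zsemi> k)"
    and zero_comp: "\<lbrakk>A \<in> obj C; k \<in> homset C B D\<rbrakk> \<Longrightarrow> zero A B \<Zsemi> k = zero A D"

locale additive_symmetric_monoidal_category =
  strict_symmetric_monoidal_category C + additive_category C plus zero
  for C :: "('o, 'm, 'x) smc_scheme" (structure)
    and plus :: "'o \<Rightarrow> 'o \<Rightarrow> 'm \<Rightarrow> 'm \<Rightarrow> 'm"
    and zero :: "'o \<Rightarrow> 'o \<Rightarrow> 'm" +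
  assumes tensor_plus: "\<lbrakk>f \<in> homset C A A'; g \<in> homset C B B'; h \<in> homset C B B'\<rbrakk>
          \<Longrightarrow> f \<otimes>\<^sub>m plus B B' g h = plus (A \<otimes>\<^sub>o B) (A' \<otimes>\<^sub>o B') (f \<otimes>\<^sub>m g) (f \<otimes>\<^sub>m h)"
    and tensor_zero: "\<lbrakk>f \<in> homset C A A'; B \<in> obj C; B' \<in> obj C\<rbrakk>
          \<Longrightarrow> f \<otimes>\<^sub>m zero B B' = zero (A \<otimes>\<^sub>o B) (A' \<otimes>\<^sub>o B')"
    and plus_tensor: "\<lbrakk>g \<in> homset C A A'; h \<in> homset C A A'; k \<in> homset C B B'\<rbrakk>
          \<Longrightarrow> plus A A' g h \<otimes>\<^sub>m k = plus (A \<otimes>\<^sub>o B) (A' \<otimes>\<^sub>o B') (g \<otimes>\<^sub>m k) (h \<otimes>\<^sub>m k)"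
    and zero_tensor: "\<lbrakk>A \<in> obj C; A' \<in> obj C; k \<in> homset C B B'\<rbrakk>
          \<Longrightarrow> zero A A' \<otimes>\<^sub>m k = zero (A \<otimes>\<^sub>o B) (A' \<otimes>\<^sub>o B')"

locale commutative_monoid_object = strict_symmetric_monoidal_category C
  for C :: "('o, 'm, 'x) smc_scheme" (structure) +
  fixes M :: 'o and mlt :: 'm and unt :: 'm
  assumes monoid_obj: "M \<in> obj C"
    and mlt_hom: "mlt \<in> homset C (M \<otimes>\<^sub>o M) M"
    and unt_hom: "unt \<in> homset C \<I> M"
    and mlt_assoc: "(mlt \<otimes>\<^sub>m \<iota> M) \<Zsemi> mlt = (\<iota> M \<otimes>\<^sub>m mlt) \<Zsemi> mlt"
    and unt_left: "(unt \<otimes>\<^sub>m \<iota> M) \<Zsemi> mlt = \<iota> M"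
    and unt_right: "(\<iota> M \<otimes>\<^sub>m unt) \<Zsemi> mlt = \<iota> M"
    and mlt_comm: "\<sigma> M M \<Zsemi> mlt = mlt"

locale cocommutative_comonoid_object = strict_symmetric_monoidal_category C
  for C :: "('o, 'm, 'x) smc_scheme" (structure) +
  fixes M :: 'o and cmlt :: 'm and cunt :: 'm
  assumes comonoid_obj: "M \<in> obj C"
    and cmlt_hom: "cmlt \<in> homset C M (M \<otimes>\<^sub>o M)"
    and cunt_hom: "cunt \<in> homset C M \<I>"
    and cmlt_coassoc: "cmlt \<Zsemi> (cmlt \<otimes>\<^sub>m \<iota> M) = cmlt \<Zsemi> (\<iota> M \<otimes>\<^sub>m cmlt)"
    and cunt_left: "cmlt \<Zsemi> (cunt \<otimes>\<^sub>m \<iota> M) = \<iota> M"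
    and cunt_right: "cmlt \<Zsemi> (\<iota> M \<otimes>\<^sub>m cunt) = \<iota> M"
    and cmlt_cocomm: "cmlt \<Zsemi> \<sigma> M M = cmlt"

locale bicommutative_bimonoid_object =
  commutative_monoid_object C M mlt unt + cocommutative_comonoid_object C M cmlt cunt
  for C :: "('o, 'm, 'x) smc_scheme" (structure)
    and M :: 'o and mlt unt cmlt cunt :: 'm +
  assumes mlt_cmlt: "mlt \<Zsemi> cmlt = (cmlt \<otimes>\<^sub>m cmlt) \<Zsemi> (\<iota> M \<otimes>\<^sub>m \<sigma> M M \<otimes>\<^sub>m \<iota> M) \<Zsemi> (mlt \<otimes>\<^sub>m mlt)"
    and mlt_cunt: "mlt \<Zsemi> cunt = cunt \<otimes>\<^sub>m cunt"
    and unt_cmlt: "unt \<Zsemi> cmlt = unt \<otimes>\<^sub>m unt"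
    and unt_cunt: "unt \<Zsemi> cunt = \<iota> \<I>"

text \<open>
  In the following, \<open>bang\<close> and \<open>bangm\<close> are the object and arrow parts of the endofunctor \<open>!\<close>.
\<close>

locale endofunctor = category C
  for C :: "('o, 'm, 'x) category_scheme" (structure) +
  fixes bang :: "'o \<Rightarrow> 'o" and bangm :: "'m \<Rightarrow> 'm"
  assumes bang_obj: "A \<in> obj C \<Longrightarrow> bang A \<in> obj C"
    and bangm_hom: "f \<in> homset C A B \<Longrightarrow> bangm f \<in> homset C (bang A) (bang B)"
    and bangm_ident: "A \<in> obj C \<Longrightarrow> bangm (\<iota> A) = \<iota> (bang A)"
    and bangm_comp: "\<lbrakk>f \<in> homset C A B; g \<in> homset C B D\<rbrakk> \<Longrightarrow> bangm (f \<Zsemi> g) = bangm f \<Zsemi> bangm g"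

locale comonad = endofunctor C bang bangm
  for C :: "('o, 'm, 'x) category_scheme" (structure)
    and bang :: "'o \<Rightarrow> 'o" and bangm :: "'m \<Rightarrow> 'm" +
  fixes \<delta> \<epsilon> :: "'o \<Rightarrow> 'm"
  assumes \<delta>_hom: "A \<in> obj C \<Longrightarrow> \<delta> A \<in> homset C (bang A) (bang (bang A))"
    and \<epsilon>_hom: "A \<in> obj C \<Longrightarrow> \<epsilon> A \<in> homset C (bang A) A"
    and \<delta>_natural: "f \<in> homset C A B \<Longrightarrow> bangm f \<Zsemi> \<delta> B = \<delta> A \<Zsemi> bangm (bangm f)"
    and \<epsilon>_natural: "f \<in> homset C A B \<Longrightarrow> bangm f \<Zsemi> \<epsilon> B = \<epsilon> A \<Zsemi> f"
    and \<delta>_coassoc: "A \<in> obj C \<Longrightarrow> \<delta> A \<Zsemi> \<delta> (bang A) = \<delta> A \<Zsemi> bangm (\<delta> A)"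
    and \<delta>_\<epsilon>_bang: "A \<in> obj C \<Longrightarrow> \<delta> A \<Zsemi> \<epsilon> (bang A) = \<iota> (bang A)"
    and \<delta>_bangm_\<epsilon>: "A \<in> obj C \<Longrightarrow> \<delta> A \<Zsemi> bangm (\<epsilon> A) = \<iota> (bang A)"

locale coalgebra_modality =
  strict_symmetric_monoidal_category C + comonad C bang bangm \<delta> \<epsilon>
  for C :: "('o, 'm, 'x) smc_scheme" (structure)
    and bang :: "'o \<Rightarrow> 'o" and bangm :: "'m \<Rightarrow> 'm" and \<delta> \<epsilon> :: "'o \<Rightarrow> 'm" +
  fixes \<Delta> e :: "'o \<Rightarrow> 'm"
  assumes \<Delta>_natural: "f \<in> homset C A B \<Longrightarrow> bangm f \<Zsemi> \<Delta> B = \<Delta> A \<Zsemi> (bangm f \<otimes>\<^sub>m bangm f)"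
    and e_natural: "f \<in> homset C A B \<Longrightarrow> bangm f \<Zsemi> e B = e A"
    and bang_comonoid: "A \<in> obj C \<Longrightarrow> cocommutative_comonoid_object C (bang A) (\<Delta> A) (e A)"
    and \<delta>_\<Delta>: "A \<in> obj C \<Longrightarrow> \<delta> A \<Zsemi> \<Delta> (bang A) = \<Delta> A \<Zsemi> (\<delta> A \<otimes>\<^sub>m \<delta> A)"
    and \<delta>_e: "A \<in> obj C \<Longrightarrow> \<delta> A \<Zsemi> e (bang A) = e A"

locale symmetric_monoidal_endofunctor =
  strict_symmetric_monoidal_category C + endofunctor C bang bangm
  for C :: "('o, 'm, 'x) smc_scheme" (structure)
    and bang :: "'o \<Rightarrow> 'o" and bangm :: "'m \<Rightarrow> 'm" +
  fixes m :: "'o \<Rightarrow> 'o \<Rightarrow> 'm" and mI :: 'm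
  assumes m_hom: "\<lbrakk>A \<in> obj C; B \<in> obj C\<rbrakk> \<Longrightarrow> m A B \<in> homset C (bang A \<otimes>\<^sub>o bang B) (bang (A \<otimes>\<^sub>o B))"
    and mI_hom: "mI \<in> homset C \<I> (bang \<I>)"
    and m_natural: "\<lbrakk>f \<in> homset C A A'; g \<in> homset C B B'\<rbrakk>
          \<Longrightarrow> (bangm f \<otimes>\<^sub>m bangm g) \<Zsemi> m A' B' = m A B \<Zsemi> bangm (f \<otimes>\<^sub>m g)"
    and m_assoc: "\<lbrakk>A \<in> obj C; B \<in> obj C; D \<in> obj C\<rbrakk>
          \<Longrightarrow> (m A B \<otimes>\<^sub>m \<iota> (bang D)) \<Zsemi> m (A \<otimes>\<^sub>o B) D = (\<iota> (bang A) \<otimes>\<^sub>m m B D) \<Zsemi> m A (B \<otimes>\<^sub>o D)"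
    and m_unit_left: "A \<in> obj C \<Longrightarrow> (mI \<otimes>\<^sub>m \<iota> (bang A)) \<Zsemi> m \<I> A = \<iota> (bang A)"
    and m_unit_right: "A \<in> obj C \<Longrightarrow> (\<iota> (bang A) \<otimes>\<^sub>m mI) \<Zsemi> m A \<I> = \<iota> (bang A)"
    and m_sym: "\<lbrakk>A \<in> obj C; B \<in> obj C\<rbrakk> \<Longrightarrow> \<sigma> (bang A) (bang B) \<Zsemi> m B A = m A B \<Zsemi> bangm (\<sigma> A B)"

locale monoidal_coalgebra_modality =
  coalgebra_modality C bang bangm \<delta> \<epsilon> \<Delta> e + symmetric_monoidal_endofunctor C bang bangm m mI
  for C :: "('o, 'm, 'x) smc_scheme" (structure)
    and bang :: "'o \<Rightarrow> 'o" and bangm :: "'m \<Rightarrow> 'm" and \<delta> \<epsilon> \<Delta> e :: "'o \<Rightarrow> 'm"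
    and m :: "'o \<Rightarrow> 'o \<Rightarrow> 'm" and mI :: 'm +
  assumes m_\<delta>: "\<lbrakk>A \<in> obj C; B \<in> obj C\<rbrakk>
          \<Longrightarrow> m A B \<Zsemi> \<delta> (A \<otimes>\<^sub>o B) = (\<delta> A \<otimes>\<^sub>m \<delta> B) \<Zsemi> m (bang A) (bang B) \<Zsemi> bangm (m A B)"
    and mI_\<delta>: "mI \<Zsemi> \<delta> \<I> = mI \<Zsemi> bangm mI"
    and m_\<epsilon>: "\<lbrakk>A \<in> obj C; B \<in> obj C\<rbrakk> \<Longrightarrow> m A B \<Zsemi> \<epsilon> (A \<otimes>\<^sub>o B) = \<epsilon> A \<otimes>\<^sub>m \<epsilon> B"
    and mI_\<epsilon>: "mI \<Zsemi> \<epsilon> \<I> = \<iota> \<I>"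
    and m_\<Delta>: "\<lbrakk>A \<in> obj C; B \<in> obj C\<rbrakk>
          \<Longrightarrow> m A B \<Zsemi> \<Delta> (A \<otimes>\<^sub>o B)
            = (\<Delta> A \<otimes>\<^sub>m \<Delta> B) \<Zsemi> (\<iota> (bang A) \<otimes>\<^sub>m \<sigma> (bang A) (bang B) \<otimes>\<^sub>m \<iota> (bang B)) \<Zsemi> (m A B \<otimes>\<^sub>m m A B)"
    and m_e: "\<lbrakk>A \<in> obj C; B \<in> obj C\<rbrakk> \<Longrightarrow> m A B \<Zsemi> e (A \<otimes>\<^sub>o B) = e A \<otimes>\<^sub>m e B"
    and mI_\<Delta>: "mI \<Zsemi> \<Delta> \<I> = mI \<otimes>\<^sub>m mI"
    and mI_e: "mI \<Zsemi> e \<I> = \<iota> \<I>"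
    and \<delta>_bangm_\<Delta>: "A \<in> obj C \<Longrightarrow> \<delta> A \<Zsemi> bangm (\<Delta> A) = \<Delta> A \<Zsemi> (\<delta> A \<otimes>\<^sub>m \<delta> A) \<Zsemi> m (bang A) (bang A)"
    and \<delta>_bangm_e: "A \<in> obj C \<Longrightarrow> \<delta> A \<Zsemi> bangm (e A) = e A \<Zsemi> mI"

locale bialgebra_modality = coalgebra_modality C bang bangm \<delta> \<epsilon> \<Delta> e
  for C :: "('o, 'm, 'x) smc_scheme" (structure)
    and bang :: "'o \<Rightarrow> 'o" and bangm :: "'m \<Rightarrow> 'm" and \<delta> \<epsilon> \<Delta> e :: "'o \<Rightarrow> 'm" +
  fixes nabla :: "'o \<Rightarrow> 'm" ("\<nabla>") and u :: "'o \<Rightarrow> 'm"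
  assumes nabla_natural: "f \<in> homset C A B \<Longrightarrow> (bangm f \<otimes>\<^sub>m bangm f) \<Zsemi> \<nabla> B = \<nabla> A \<Zsemi> bangm f"
    and u_natural: "f \<in> homset C A B \<Longrightarrow> u A \<Zsemi> bangm f = u B"
    and bang_bimonoid: "A \<in> obj C \<Longrightarrow> bicommutative_bimonoid_object C (bang A) (\<nabla> A) (u A) (\<Delta> A) (e A)"

locale monoidal_bialgebra_modality =
  monoidal_coalgebra_modality C bang bangm \<delta> \<epsilon> \<Delta> e m mI +
  bialgebra_modality C bang bangm \<delta> \<epsilon> \<Delta> e nabla u
  for C :: "('o, 'm, 'x) smc_scheme" (structure)
    and bang :: "'o \<Rightarrow> 'o" and bangm :: "'m \<Rightarrow> 'm" and \<delta> \<epsilon> \<Delta> e :: "'o \<Rightarrow> 'm"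
    and m :: "'o \<Rightarrow> 'o \<Rightarrow> 'm" and mI :: 'm
    and nabla :: "'o \<Rightarrow> 'm" ("\<nabla>") and u :: "'o \<Rightarrow> 'm" +
  assumes nabla_m_right: "\<lbrakk>A \<in> obj C; B \<in> obj C\<rbrakk>
          \<Longrightarrow> (\<iota> (bang A) \<otimes>\<^sub>m \<nabla> B) \<Zsemi> m A B
            = (\<Delta> A \<otimes>\<^sub>m \<iota> (bang B) \<otimes>\<^sub>m \<iota> (bang B))
              \<Zsemi> (\<iota> (bang A) \<otimes>\<^sub>m \<sigma> (bang A) (bang B) \<otimes>\<^sub>m \<iota> (bang B)) \<Zsemi> (m A B \<otimes>\<^sub>m m A B) \<Zsemi> \<nabla> (A \<otimes>\<^sub>o B)"
    and nabla_m_left: "\<lbrakk>A \<in> obj C; B \<in> obj C\<rbrakk>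
          \<Longrightarrow> (\<nabla> A \<otimes>\<^sub>m \<iota> (bang B)) \<Zsemi> m A B
            = (\<iota> (bang A) \<otimes>\<^sub>m \<iota> (bang A) \<otimes>\<^sub>m \<Delta> B)
              \<Zsemi> (\<iota> (bang A) \<otimes>\<^sub>m \<sigma> (bang A) (bang B) \<otimes>\<^sub>m \<iota> (bang B)) \<Zsemi> (m A B \<otimes>\<^sub>m m A B) \<Zsemi> \<nabla> (A \<otimes>\<^sub>o B)"
    and u_m_left: "\<lbrakk>A \<in> obj C; B \<in> obj C\<rbrakk> \<Longrightarrow> (u A \<otimes>\<^sub>m \<iota> (bang B)) \<Zsemi> m A B = e B \<Zsemi> u (A \<otimes>\<^sub>o B)"
    and u_m_right: "\<lbrakk>A \<in> obj C; B \<in> obj C\<rbrakk> \<Longrightarrow> (\<iota> (bang A) \<otimes>\<^sub>m u B) \<Zsemi> m A B = e A \<Zsemi> u (A \<otimes>\<^sub>o B)"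
    and nabla_\<delta>: "A \<in> obj C \<Longrightarrow> \<nabla> A \<Zsemi> \<delta> A = (\<delta> A \<otimes>\<^sub>m \<delta> A) \<Zsemi> m (bang A) (bang A) \<Zsemi> bangm (\<nabla> A)"
    and u_\<delta>: "A \<in> obj C \<Longrightarrow> u A \<Zsemi> \<delta> A = mI \<Zsemi> bangm (u A)"

locale pre_codereliction = monoidal_coalgebra_modality C bang bangm \<delta> \<epsilon> \<Delta> e m mI
  for C :: "('o, 'm, 'x) smc_scheme" (structure)
    and bang :: "'o \<Rightarrow> 'o" and bangm :: "'m \<Rightarrow> 'm" and \<delta> \<epsilon> \<Delta> e :: "'o \<Rightarrow> 'm"
    and m :: "'o \<Rightarrow> 'o \<Rightarrow> 'm" and mI :: 'm +
  fixes \<eta> :: "'o \<Rightarrow> 'm"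
  assumes \<eta>_hom: "A \<in> obj C \<Longrightarrow> \<eta> A \<in> homset C A (bang A)"
    and \<eta>_natural: "f \<in> homset C A B \<Longrightarrow> f \<Zsemi> \<eta> B = \<eta> A \<Zsemi> bangm f"
    and \<eta>_\<epsilon>: "A \<in> obj C \<Longrightarrow> \<eta> A \<Zsemi> \<epsilon> A = \<iota> A"
    and \<eta>_m_left: "\<lbrakk>A \<in> obj C; B \<in> obj C\<rbrakk> \<Longrightarrow> (\<eta> A \<otimes>\<^sub>m \<iota> (bang B)) \<Zsemi> m A B = (\<iota> A \<otimes>\<^sub>m \<epsilon> B) \<Zsemi> \<eta> (A \<otimes>\<^sub>o B)"
    and \<eta>_m_right: "\<lbrakk>A \<in> obj C; B \<in> obj C\<rbrakk> \<Longrightarrow> (\<iota> (bang A) \<otimes>\<^sub>m \<eta> B) \<Zsemi> m A B = (\<epsilon> A \<otimes>\<^sub>m \<iota> B) \<Zsemi> \<eta> (A \<otimes>\<^sub>o B)"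

end

theory Submission
  imports Defs
begin

text \<open>
  For arrows \<open>F\<close> and \<open>G\<close> from \<open>!A\<close> to \<open>!B\<close>, the comonoid structure of \<open>!A\<close> and the monoid structure
  of \<open>!B\<close> give the convolution \<open>\<Delta> A \<Zsemi> (F \<otimes> G) \<Zsemi> \<nabla> B\<close>, which is always associative and commutative
  with unit \<open>e A \<Zsemi> u B\<close>. The sum of \<open>f\<close> and \<open>g\<close> is \<open>\<eta> A \<Zsemi> F \<Zsemi> \<epsilon> B\<close>, where \<open>F\<close> is the convolution of
  \<open>!f\<close> and \<open>!g\<close>. So the monoid laws for the sum follow once \<open>!\<close> turns sums into convolutions, that is,
  \<open>!(f + g) = F\<close> and \<open>!0 = e A \<Zsemi> u B\<close>; this is the heart of the proof.

  Two properties of \<open>F\<close> combine to give \<open>!(\<eta> A \<Zsemi> F \<Zsemi> \<epsilon> B) = F\<close> (\<open>bang_linearization\<close>). Firstly, \<open>F\<close> is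
  a morphism of cofree coalgebras, \<open>F \<Zsemi> \<delta> B = \<delta> A \<Zsemi> !F\<close>, so it is determined by \<open>F \<Zsemi> \<epsilon> B\<close>. Secondly,
  \<open>F\<close> is linear: \<open>F \<Zsemi> \<epsilon> B = \<epsilon> A \<Zsemi> (\<eta> A \<Zsemi> F \<Zsemi> \<epsilon> B)\<close>. This second point uses that, by the axiom relating
  \<open>\<eta>\<close> and \<open>m\<close>, the idempotent \<open>\<epsilon> A \<Zsemi> \<eta> A\<close> is \<open>m \<I> A\<close> with \<open>\<eta> \<I>\<close> plugged into its first argument. Since
  \<open>m\<close> distributes over convolution in its second argument, \<open>F\<close> commutes with these idempotents, and
  \<open>\<eta> B \<Zsemi> \<epsilon> B = \<iota> B\<close> absorbs the one on the side of \<open>B\<close>.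

  The same distributivity of \<open>m\<close> over convolution (\<open>m_bang_convolution\<close>, \<open>m_convolution_unit\<close>) also
  yields the distributivity of \<open>\<otimes>\<close> over sums, because
  \<open>\<eta> (A \<otimes> B) = (\<eta> A \<otimes> \<eta> B) \<Zsemi> m A B\<close>. Distributivity of composition is just naturality.
\<close>

section \<open>Strict symmetric monoidal categories\<close>

context category
begin

text \<open>
  Stating typing through source and target equations, rather than through membership in homsets,
  lets the simplifier discharge the side conditions of the category laws; strict associativity of
  \<open>\<otimes>\<close> on objects is then also handled by rewriting.
\<close>
lemma homset_iff: "f \<in> homset C A B \<longleftrightarrow> f \<in> arr C \<and> src C f = A \<and> tgt C f = B"
  by (simp add: homset_def)

lemma homset_obj: "f \<in> homset C A B \<Longrightarrow> A \<in> obj C" "f \<in> homset C A B \<Longrightarrow> B \<in> obj C"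
  using src_obj tgt_obj by (auto simp: homset_iff)

lemma src_tgt_obj [simp]: "f \<in> arr C \<Longrightarrow> src C f \<in> obj C" "f \<in> arr C \<Longrightarrow> tgt C f \<in> obj C"
  using src_obj tgt_obj by auto

lemma ident_typing [simp]:
  assumes "A \<in> obj C"
  shows "\<iota> A \<in> arr C" "src C (\<iota> A) = A" "tgt C (\<iota> A) = A"
  using ident_hom[OF assms] by (auto simp: homset_iff)

lemma comp_typing [simp]:
  assumes "f \<in> arr C" "g \<in> arr C" "tgt C f = src C g"
  shows "f \<Zsemi> g \<in> arr C" "src C (f \<Zsemi> g) = src C f" "tgt C (f \<Zsemi> g) = tgt C g"
  using comp_hom[of f "src C f" "tgt C f" g "tgt C g"] assms by (auto simp: homset_iff)

lemma assoc:
  assumes "f \<in> arr C" "g \<in> arr C" "h \<in> arr C" "tgt C f = src C g" "tgt C g = src C h"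
  shows "(f \<Zsemi> g) \<Zsemi> h = f \<Zsemi> (g \<Zsemi> h)"
  using assms by (intro comp_assoc) (auto simp: homset_iff)

lemma ident_comp [simp]:
  assumes "f \<in> arr C"
  shows "src C f = A \<Longrightarrow> \<iota> A \<Zsemi> f = f" "tgt C f = A \<Longrightarrow> f \<Zsemi> \<iota> A = f"
  using ident_left[of f "src C f" "tgt C f"] ident_right[of f "src C f" "tgt C f"] assms
  by (auto simp: homset_iff)

end

context strict_symmetric_monoidal_category
begin

lemma tensor_typing [simp]:
  assumes "f \<in> arr C" "g \<in> arr C"
  shows "f \<otimes>\<^sub>m g \<in> arr C"
    "src C (f \<otimes>\<^sub>m g) = src C f \<otimes>\<^sub>o src C g"
    "tgt C (f \<otimes>\<^sub>m g) = tgt C f \<otimes>\<^sub>o tgt C g"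
  using tensor_hom[of f "src C f" "tgt C f" g "src C g" "tgt C g"] assms by (auto simp: homset_iff)

lemma sym_typing [simp]:
  assumes "A \<in> obj C" "B \<in> obj C"
  shows "\<sigma> A B \<in> arr C" "src C (\<sigma> A B) = A \<otimes>\<^sub>o B" "tgt C (\<sigma> A B) = B \<otimes>\<^sub>o A"
  using sym_hom[OF assms] by (auto simp: homset_iff)

lemma interchange:
  assumes "f \<in> arr C" "f' \<in> arr C" "g \<in> arr C" "g' \<in> arr C"
    "tgt C f = src C f'" "tgt C g = src C g'"
  shows "(f \<otimes>\<^sub>m g) \<Zsemi> (f' \<otimes>\<^sub>m g') = (f \<Zsemi> f') \<otimes>\<^sub>m (g \<Zsemi> g')"
  using assms by (intro tensor_comp[symmetric]) (auto simp: homset_iff)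

lemmas strict [simp] =
  unit_obj tensor_obj tensor_obj_assoc tensor_obj_unit_left tensor_obj_unit_right
  tensor_arr_unit_left tensor_arr_unit_right tensor_ident

abbreviation middle_swap where
  "middle_swap A B D E \<equiv> \<iota> A \<otimes>\<^sub>m \<sigma> B D \<otimes>\<^sub>m \<iota> E"

lemma middle_swap_natural:
  assumes "a \<in> homset C A A'" "b \<in> homset C B B'" "c \<in> homset C D D'" "d \<in> homset C E E'"
  shows "((a \<otimes>\<^sub>m b) \<otimes>\<^sub>m (c \<otimes>\<^sub>m d)) \<Zsemi> middle_swap A' B' D' E'
    = middle_swap A B D E \<Zsemi> ((a \<otimes>\<^sub>m c) \<otimes>\<^sub>m (b \<otimes>\<^sub>m d))"
proof -
  note [simp] = assms[unfolded homset_iff] homset_obj[OF assms(1)] homset_obj[OF assms(2)]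
    homset_obj[OF assms(3)] homset_obj[OF assms(4)]
  have "((a \<otimes>\<^sub>m b) \<otimes>\<^sub>m (c \<otimes>\<^sub>m d)) \<Zsemi> middle_swap A' B' D' E'
    = (a \<otimes>\<^sub>m (b \<otimes>\<^sub>m c) \<otimes>\<^sub>m d) \<Zsemi> middle_swap A' B' D' E'"
    by (simp add: tensor_arr_assoc)
  also have "\<dots> = a \<otimes>\<^sub>m ((b \<otimes>\<^sub>m c) \<Zsemi> \<sigma> B' D') \<otimes>\<^sub>m d"
    by (simp add: interchange)
  also have "(b \<otimes>\<^sub>m c) \<Zsemi> \<sigma> B' D' = \<sigma> B D \<Zsemi> (c \<otimes>\<^sub>m b)"
    using sym_natural assms(2,3) .
  also have "a \<otimes>\<^sub>m (\<sigma> B D \<Zsemi> (c \<otimes>\<^sub>m b)) \<otimes>\<^sub>m d = middle_swap A B D E \<Zsemi> (a \<otimes>\<^sub>m (c \<otimes>\<^sub>m b) \<otimes>\<^sub>m d)"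
    by (simp add: interchange)
  also have "\<dots> = middle_swap A B D E \<Zsemi> ((a \<otimes>\<^sub>m c) \<otimes>\<^sub>m (b \<otimes>\<^sub>m d))"
    by (simp add: tensor_arr_assoc)
  finally show ?thesis .
qed

lemma sym_conjugate:
  assumes "f \<in> homset C A A'" "g \<in> homset C B B'"
  shows "\<sigma> B A \<Zsemi> (f \<otimes>\<^sub>m g) \<Zsemi> \<sigma> A' B' = g \<otimes>\<^sub>m f"
proof -
  note [simp] = assms[unfolded homset_iff] homset_obj[OF assms(1)] homset_obj[OF assms(2)]
  have "\<sigma> B A \<Zsemi> (f \<otimes>\<^sub>m g) \<Zsemi> \<sigma> A' B' = \<sigma> B A \<Zsemi> (\<sigma> A B \<Zsemi> (g \<otimes>\<^sub>m f))"
    using sym_natural[OF assms] by (simp add: assoc)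
  also have "\<dots> = g \<otimes>\<^sub>m f"
    by (simp add: sym_sym flip: assoc)
  finally show ?thesis .
qed

end

section \<open>Convolution on homsets between exponentials\<close>

locale pre_codereliction_bialgebra_modality =
  monoidal_bialgebra_modality C bang bangm \<delta> \<epsilon> \<Delta> e m mI nabla u +
  pre_codereliction C bang bangm \<delta> \<epsilon> \<Delta> e m mI \<eta>
  for C :: "('o, 'm, 'x) smc_scheme" (structure)
    and bang :: "'o \<Rightarrow> 'o" and bangm :: "'m \<Rightarrow> 'm" and \<delta> \<epsilon> \<Delta> e :: "'o \<Rightarrow> 'm"
    and m :: "'o \<Rightarrow> 'o \<Rightarrow> 'm" and mI :: 'm
    and nabla :: "'o \<Rightarrow> 'm" ("\<nabla>") and u :: "'o \<Rightarrow> 'm" and \<eta> :: "'o \<Rightarrow> 'm"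
begin

lemmas bang_obj [simp]

lemma bangm_typing [simp]:
  assumes "f \<in> arr C"
  shows "bangm f \<in> arr C" "src C (bangm f) = bang (src C f)" "tgt C (bangm f) = bang (tgt C f)"
  using bangm_hom[of f "src C f" "tgt C f"] assms by (auto simp: homset_iff)

lemma bang_comp:
  assumes "f \<in> arr C" "g \<in> arr C" "tgt C f = src C g"
  shows "bangm f \<Zsemi> bangm g = bangm (f \<Zsemi> g)"
  using assms by (intro bangm_comp[symmetric]) (auto simp: homset_iff)

lemmas bang_monoid = bicommutative_bimonoid_object.axioms(1)[OF bang_bimonoid]

lemma structure_typing [simp]:
  assumes "A \<in> obj C"
  shows "\<delta> A \<in> arr C" "src C (\<delta> A) = bang A" "tgt C (\<delta> A) = bang (bang A)"
    "\<epsilon> A \<in> arr C" "src C (\<epsilon> A) = bang A" "tgt C (\<epsilon> A) = A"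
    "\<eta> A \<in> arr C" "src C (\<eta> A) = A" "tgt C (\<eta> A) = bang A"
    "\<Delta> A \<in> arr C" "src C (\<Delta> A) = bang A" "tgt C (\<Delta> A) = bang A \<otimes>\<^sub>o bang A"
    "e A \<in> arr C" "src C (e A) = bang A" "tgt C (e A) = \<I>"
    "\<nabla> A \<in> arr C" "src C (\<nabla> A) = bang A \<otimes>\<^sub>o bang A" "tgt C (\<nabla> A) = bang A"
    "u A \<in> arr C" "src C (u A) = \<I>" "tgt C (u A) = bang A"
  using \<delta>_hom[OF assms] \<epsilon>_hom[OF assms] \<eta>_hom[OF assms]
    cocommutative_comonoid_object.cmlt_hom[OF bang_comonoid[OF assms]]
    cocommutative_comonoid_object.cunt_hom[OF bang_comonoid[OF assms]]
    commutative_monoid_object.mlt_hom[OF bang_monoid[OF assms]]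
    commutative_monoid_object.unt_hom[OF bang_monoid[OF assms]]
  by (auto simp: homset_iff)

lemma m_typing [simp]:
  assumes "A \<in> obj C" "B \<in> obj C"
  shows "m A B \<in> arr C" "src C (m A B) = bang A \<otimes>\<^sub>o bang B" "tgt C (m A B) = bang (A \<otimes>\<^sub>o B)"
  using m_hom[OF assms] by (auto simp: homset_iff)

lemma mI_typing [simp]: "mI \<in> arr C" "src C mI = \<I>" "tgt C mI = bang \<I>"
  using mI_hom by (auto simp: homset_iff)

definition convolution where
  "convolution A B F G = \<Delta> A \<Zsemi> (F \<otimes>\<^sub>m G) \<Zsemi> \<nabla> B"

definition convolution_unit where
  "convolution_unit A B = e A \<Zsemi> u B"

definition linearization where
  "linearization A B F = \<eta> A \<Zsemi> F \<Zsemi> \<epsilon> B"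

lemma convolution_hom:
  assumes "F \<in> homset C (bang A) (bang B)" "G \<in> homset C (bang A) (bang B)" "A \<in> obj C" "B \<in> obj C"
  shows "convolution A B F G \<in> homset C (bang A) (bang B)"
  using assms by (simp add: homset_iff convolution_def)

lemma convolution_unit_hom:
  assumes "A \<in> obj C" "B \<in> obj C"
  shows "convolution_unit A B \<in> homset C (bang A) (bang B)"
  using assms by (simp add: homset_iff convolution_unit_def)

lemma linearization_hom:
  assumes "F \<in> homset C (bang A) (bang B)" "A \<in> obj C" "B \<in> obj C"
  shows "linearization A B F \<in> homset C A B"
  using assms by (simp add: homset_iff linearization_def)

lemma convolution_assoc:
  assumes [simp]: "A \<in> obj C" "B \<in> obj C"
    and FGH: "F \<in> homset C (bang A) (bang B)" "G \<in> homset C (bang A) (bang B)" "H \<in> homset C (bang A) (bang B)"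
  shows "convolution A B (convolution A B F G) H = convolution A B F (convolution A B G H)"
proof -
  note [simp] = FGH[unfolded homset_iff]
  have coassoc: "\<Delta> A \<Zsemi> (\<Delta> A \<otimes>\<^sub>m \<iota> (bang A)) = \<Delta> A \<Zsemi> (\<iota> (bang A) \<otimes>\<^sub>m \<Delta> A)"
    using cocommutative_comonoid_object.cmlt_coassoc[OF bang_comonoid[of A]] by simp
  have assoc': "(\<nabla> B \<otimes>\<^sub>m \<iota> (bang B)) \<Zsemi> \<nabla> B = (\<iota> (bang B) \<otimes>\<^sub>m \<nabla> B) \<Zsemi> \<nabla> B"
    using commutative_monoid_object.mlt_assoc[OF bang_monoid[of B]] by simp
  have "convolution A B (convolution A B F G) H
    = (\<Delta> A \<Zsemi> (\<Delta> A \<otimes>\<^sub>m \<iota> (bang A))) \<Zsemi> ((F \<otimes>\<^sub>m G) \<otimes>\<^sub>m H) \<Zsemi> ((\<nabla> B \<otimes>\<^sub>m \<iota> (bang B)) \<Zsemi> \<nabla> B)"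
  proof -
    have "convolution A B F G \<otimes>\<^sub>m H
      = (\<Delta> A \<otimes>\<^sub>m \<iota> (bang A)) \<Zsemi> ((F \<otimes>\<^sub>m G) \<otimes>\<^sub>m H) \<Zsemi> (\<nabla> B \<otimes>\<^sub>m \<iota> (bang B))"
      by (simp add: interchange convolution_def)
    then show ?thesis
      unfolding convolution_def[of _ _ _ H] by (simp add: assoc)
  qed
  also have "\<dots> = (\<Delta> A \<Zsemi> (\<iota> (bang A) \<otimes>\<^sub>m \<Delta> A)) \<Zsemi> (F \<otimes>\<^sub>m (G \<otimes>\<^sub>m H)) \<Zsemi> ((\<iota> (bang B) \<otimes>\<^sub>m \<nabla> B) \<Zsemi> \<nabla> B)"
    by (simp add: coassoc assoc' tensor_arr_assoc)
  also have "\<dots> = convolution A B F (convolution A B G H)"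
  proof -
    have "F \<otimes>\<^sub>m convolution A B G H
      = (\<iota> (bang A) \<otimes>\<^sub>m \<Delta> A) \<Zsemi> (F \<otimes>\<^sub>m (G \<otimes>\<^sub>m H)) \<Zsemi> (\<iota> (bang B) \<otimes>\<^sub>m \<nabla> B)"
      by (simp add: interchange convolution_def)
    then show ?thesis
      unfolding convolution_def[of _ _ F] by (simp add: assoc)
  qed
  finally show ?thesis .
qed

lemma convolution_comm:
  assumes [simp]: "A \<in> obj C" "B \<in> obj C"
    and FG: "F \<in> homset C (bang A) (bang B)" "G \<in> homset C (bang A) (bang B)"
  shows "convolution A B F G = convolution A B G F"
proof -
  note [simp] = FG[unfolded homset_iff]
  have cocomm: "\<Delta> A \<Zsemi> \<sigma> (bang A) (bang A) = \<Delta> A"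
    using cocommutative_comonoid_object.cmlt_cocomm[OF bang_comonoid[of A]] by simp
  have comm: "\<sigma> (bang B) (bang B) \<Zsemi> \<nabla> B = \<nabla> B"
    using commutative_monoid_object.mlt_comm[OF bang_monoid[of B]] by simp
  have "convolution A B F G = \<Delta> A \<Zsemi> ((F \<otimes>\<^sub>m G) \<Zsemi> \<sigma> (bang B) (bang B)) \<Zsemi> \<nabla> B"
    by (simp add: convolution_def assoc comm)
  also have "\<dots> = (\<Delta> A \<Zsemi> \<sigma> (bang A) (bang A)) \<Zsemi> (G \<otimes>\<^sub>m F) \<Zsemi> \<nabla> B"
    by (simp add: sym_natural[OF FG] assoc)
  also have "\<dots> = convolution A B G F"
    by (simp add: cocomm convolution_def)
  finally show ?thesis .
qed

lemma convolution_unit_left: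
  assumes [simp]: "A \<in> obj C" "B \<in> obj C" and F: "F \<in> homset C (bang A) (bang B)"
  shows "convolution A B (convolution_unit A B) F = F"
proof -
  note [simp] = F[unfolded homset_iff]
  have counit: "\<Delta> A \<Zsemi> (e A \<otimes>\<^sub>m \<iota> (bang A)) = \<iota> (bang A)"
    using cocommutative_comonoid_object.cunt_left[OF bang_comonoid[of A]] by simp
  have unit: "(u B \<otimes>\<^sub>m \<iota> (bang B)) \<Zsemi> \<nabla> B = \<iota> (bang B)"
    using commutative_monoid_object.unt_left[OF bang_monoid[of B]] by simp
  have "convolution_unit A B \<otimes>\<^sub>m F = (e A \<otimes>\<^sub>m \<iota> (bang A)) \<Zsemi> (\<iota> \<I> \<otimes>\<^sub>m F) \<Zsemi> (u B \<otimes>\<^sub>m \<iota> (bang B))"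
    unfolding convolution_unit_def by (simp add: interchange del: tensor_arr_unit_left)
  then have "convolution A B (convolution_unit A B) F
    = (\<Delta> A \<Zsemi> (e A \<otimes>\<^sub>m \<iota> (bang A))) \<Zsemi> F \<Zsemi> ((u B \<otimes>\<^sub>m \<iota> (bang B)) \<Zsemi> \<nabla> B)"
    by (simp add: convolution_def assoc)
  then show ?thesis
    by (simp add: counit unit)
qed

section \<open>Compatibility with the comonad and with the monoidal structure\<close>

text \<open>
  All ingredients of the convolution are coalgebra morphisms: \<open>!f\<close> and \<open>!g\<close> by naturality of \<open>\<delta>\<close>,
  and \<open>\<Delta>\<close> and \<open>\<nabla>\<close> by the axioms, where \<open>!A \<otimes> !A\<close> carries the coalgebra structure
  \<open>(\<delta> A \<otimes> \<delta> A) \<Zsemi> m (!A) (!A)\<close>.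
\<close>
lemma bang_convolution_\<delta>:
  assumes f: "f \<in> homset C A B" and g: "g \<in> homset C A B"
  defines "F \<equiv> convolution A B (bangm f) (bangm g)"
  shows "F \<Zsemi> \<delta> B = \<delta> A \<Zsemi> bangm F"
proof -
  note [simp] = f[unfolded homset_iff] g[unfolded homset_iff] homset_obj[OF f]
  have "F \<Zsemi> \<delta> B = \<Delta> A \<Zsemi> (bangm f \<otimes>\<^sub>m bangm g) \<Zsemi> (\<nabla> B \<Zsemi> \<delta> B)"
    by (simp add: F_def convolution_def assoc)
  also have "\<dots> = \<Delta> A \<Zsemi> ((bangm f \<otimes>\<^sub>m bangm g) \<Zsemi> (\<delta> B \<otimes>\<^sub>m \<delta> B)) \<Zsemi> m (bang B) (bang B) \<Zsemi> bangm (\<nabla> B)"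
    by (simp add: nabla_\<delta> assoc)
  also have "(bangm f \<otimes>\<^sub>m bangm g) \<Zsemi> (\<delta> B \<otimes>\<^sub>m \<delta> B) = (\<delta> A \<otimes>\<^sub>m \<delta> A) \<Zsemi> (bangm (bangm f) \<otimes>\<^sub>m bangm (bangm g))"
    by (simp add: interchange \<delta>_natural[OF f] \<delta>_natural[OF g])
  also have "\<Delta> A \<Zsemi> \<dots> \<Zsemi> m (bang B) (bang B) \<Zsemi> bangm (\<nabla> B)
    = \<Delta> A \<Zsemi> (\<delta> A \<otimes>\<^sub>m \<delta> A) \<Zsemi> ((bangm (bangm f) \<otimes>\<^sub>m bangm (bangm g)) \<Zsemi> m (bang B) (bang B)) \<Zsemi> bangm (\<nabla> B)"
    by (simp add: assoc)
  also have "(bangm (bangm f) \<otimes>\<^sub>m bangm (bangm g)) \<Zsemi> m (bang B) (bang B)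
    = m (bang A) (bang A) \<Zsemi> bangm (bangm f \<otimes>\<^sub>m bangm g)"
    by (rule m_natural) (auto simp: homset_iff)
  also have "\<Delta> A \<Zsemi> (\<delta> A \<otimes>\<^sub>m \<delta> A) \<Zsemi> \<dots> \<Zsemi> bangm (\<nabla> B)
    = (\<Delta> A \<Zsemi> (\<delta> A \<otimes>\<^sub>m \<delta> A) \<Zsemi> m (bang A) (bang A)) \<Zsemi> bangm (bangm f \<otimes>\<^sub>m bangm g) \<Zsemi> bangm (\<nabla> B)"
    by (simp add: assoc)
  also have "\<dots> = \<delta> A \<Zsemi> (bangm (\<Delta> A) \<Zsemi> bangm (bangm f \<otimes>\<^sub>m bangm g) \<Zsemi> bangm (\<nabla> B))"
    by (subst \<delta>_bangm_\<Delta>[symmetric]) (simp_all add: assoc)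
  also have "bangm (\<Delta> A) \<Zsemi> bangm (bangm f \<otimes>\<^sub>m bangm g) \<Zsemi> bangm (\<nabla> B) = bangm F"
    by (simp add: F_def convolution_def bang_comp)
  finally show ?thesis .
qed

lemma convolution_unit_\<delta>:
  assumes [simp]: "A \<in> obj C" "B \<in> obj C"
  shows "convolution_unit A B \<Zsemi> \<delta> B = \<delta> A \<Zsemi> bangm (convolution_unit A B)"
proof -
  have "convolution_unit A B \<Zsemi> \<delta> B = (e A \<Zsemi> mI) \<Zsemi> bangm (u B)"
    by (simp add: convolution_unit_def assoc u_\<delta>)
  also have "\<dots> = \<delta> A \<Zsemi> bangm (convolution_unit A B)"
    by (simp add: \<delta>_bangm_e[symmetric] assoc bang_comp convolution_unit_def)
  finally show ?thesis .
qed

text \<open>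
  Since \<open>m\<close> is a comonoid morphism, pushing \<open>m\<close> through \<open>\<Delta>\<close> duplicates
  the \<open>!A\<close> factor. Naturality then carries both copies past the arrows, and the axiom for
  \<open>(\<iota> \<otimes> \<nabla>) \<Zsemi> m\<close> reads backwards as merging them again.
\<close>
lemma m_bang_convolution:
  assumes h: "h \<in> homset C A A'" and f: "f \<in> homset C B B'" and g: "g \<in> homset C B B'"
  shows "m A B \<Zsemi> convolution (A \<otimes>\<^sub>o B) (A' \<otimes>\<^sub>o B') (bangm (h \<otimes>\<^sub>m f)) (bangm (h \<otimes>\<^sub>m g))
    = (bangm h \<otimes>\<^sub>m convolution B B' (bangm f) (bangm g)) \<Zsemi> m A' B'"
proof -
  note [simp] = h[unfolded homset_iff] f[unfolded homset_iff] g[unfolded homset_iff]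
    homset_obj[OF f] homset_obj[OF h]
  let ?S = "middle_swap (bang A) (bang A) (bang B) (bang B)"
  let ?S' = "middle_swap (bang A') (bang A') (bang B') (bang B')"
  have "m A B \<Zsemi> convolution (A \<otimes>\<^sub>o B) (A' \<otimes>\<^sub>o B') (bangm (h \<otimes>\<^sub>m f)) (bangm (h \<otimes>\<^sub>m g))
    = (m A B \<Zsemi> \<Delta> (A \<otimes>\<^sub>o B)) \<Zsemi> (bangm (h \<otimes>\<^sub>m f) \<otimes>\<^sub>m bangm (h \<otimes>\<^sub>m g)) \<Zsemi> \<nabla> (A' \<otimes>\<^sub>o B')"
    by (simp add: convolution_def assoc)
  also have "\<dots> = (\<Delta> A \<otimes>\<^sub>m \<Delta> B) \<Zsemi> ?S
      \<Zsemi> ((m A B \<otimes>\<^sub>m m A B) \<Zsemi> (bangm (h \<otimes>\<^sub>m f) \<otimes>\<^sub>m bangm (h \<otimes>\<^sub>m g))) \<Zsemi> \<nabla> (A' \<otimes>\<^sub>o B')"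
    by (simp add: m_\<Delta> assoc)
  also have "(m A B \<otimes>\<^sub>m m A B) \<Zsemi> (bangm (h \<otimes>\<^sub>m f) \<otimes>\<^sub>m bangm (h \<otimes>\<^sub>m g))
    = ((bangm h \<otimes>\<^sub>m bangm f) \<otimes>\<^sub>m (bangm h \<otimes>\<^sub>m bangm g)) \<Zsemi> (m A' B' \<otimes>\<^sub>m m A' B')"
    by (simp add: interchange m_natural[OF h f] m_natural[OF h g])
  also have "(\<Delta> A \<otimes>\<^sub>m \<Delta> B) \<Zsemi> ?S \<Zsemi> \<dots> \<Zsemi> \<nabla> (A' \<otimes>\<^sub>o B')
    = (\<Delta> A \<otimes>\<^sub>m \<Delta> B) \<Zsemi> (?S \<Zsemi> ((bangm h \<otimes>\<^sub>m bangm f) \<otimes>\<^sub>m (bangm h \<otimes>\<^sub>m bangm g)))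
      \<Zsemi> (m A' B' \<otimes>\<^sub>m m A' B') \<Zsemi> \<nabla> (A' \<otimes>\<^sub>o B')"
    by (simp add: assoc)
  also have "?S \<Zsemi> ((bangm h \<otimes>\<^sub>m bangm f) \<otimes>\<^sub>m (bangm h \<otimes>\<^sub>m bangm g))
    = ((bangm h \<otimes>\<^sub>m bangm h) \<otimes>\<^sub>m (bangm f \<otimes>\<^sub>m bangm g)) \<Zsemi> ?S'"
    by (rule middle_swap_natural[symmetric]) (auto simp: homset_iff)
  also have "(\<Delta> A \<otimes>\<^sub>m \<Delta> B) \<Zsemi> \<dots> \<Zsemi> (m A' B' \<otimes>\<^sub>m m A' B') \<Zsemi> \<nabla> (A' \<otimes>\<^sub>o B')
    = ((\<Delta> A \<otimes>\<^sub>m \<Delta> B) \<Zsemi> ((bangm h \<otimes>\<^sub>m bangm h) \<otimes>\<^sub>m (bangm f \<otimes>\<^sub>m bangm g)))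
      \<Zsemi> ?S' \<Zsemi> (m A' B' \<otimes>\<^sub>m m A' B') \<Zsemi> \<nabla> (A' \<otimes>\<^sub>o B')"
    by (simp add: assoc)
  also have "(\<Delta> A \<otimes>\<^sub>m \<Delta> B) \<Zsemi> ((bangm h \<otimes>\<^sub>m bangm h) \<otimes>\<^sub>m (bangm f \<otimes>\<^sub>m bangm g))
    = (\<Delta> A \<Zsemi> (bangm h \<otimes>\<^sub>m bangm h)) \<otimes>\<^sub>m (\<Delta> B \<Zsemi> (bangm f \<otimes>\<^sub>m bangm g))"
    by (simp add: interchange)
  also have "\<dots> = (bangm h \<otimes>\<^sub>m (\<Delta> B \<Zsemi> (bangm f \<otimes>\<^sub>m bangm g)))
      \<Zsemi> (\<Delta> A' \<otimes>\<^sub>m \<iota> (bang B') \<otimes>\<^sub>m \<iota> (bang B'))"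
    by (simp add: interchange \<Delta>_natural[OF h, symmetric] tensor_arr_assoc)
  also have "\<dots> \<Zsemi> ?S' \<Zsemi> (m A' B' \<otimes>\<^sub>m m A' B') \<Zsemi> \<nabla> (A' \<otimes>\<^sub>o B')
    = (bangm h \<otimes>\<^sub>m (\<Delta> B \<Zsemi> (bangm f \<otimes>\<^sub>m bangm g))) \<Zsemi> ((\<iota> (bang A') \<otimes>\<^sub>m \<nabla> B') \<Zsemi> m A' B')"
    by (simp add: nabla_m_right assoc)
  also have "\<dots> = (bangm h \<otimes>\<^sub>m convolution B B' (bangm f) (bangm g)) \<Zsemi> m A' B'"
    by (simp add: interchange convolution_def flip: assoc)
  finally show ?thesis .
qed

lemma m_convolution_unit:
  assumes h: "h \<in> homset C A A'" and [simp]: "B \<in> obj C" "B' \<in> obj C"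
  shows "m A B \<Zsemi> convolution_unit (A \<otimes>\<^sub>o B) (A' \<otimes>\<^sub>o B')
    = (bangm h \<otimes>\<^sub>m convolution_unit B B') \<Zsemi> m A' B'"
proof -
  note [simp] = h[unfolded homset_iff] homset_obj[OF h]
  have "m A B \<Zsemi> convolution_unit (A \<otimes>\<^sub>o B) (A' \<otimes>\<^sub>o B') = (e A \<otimes>\<^sub>m e B) \<Zsemi> u (A' \<otimes>\<^sub>o B')"
    by (simp add: convolution_unit_def m_e flip: assoc)
  also have "e A \<otimes>\<^sub>m e B = (bangm h \<otimes>\<^sub>m e B) \<Zsemi> (e A' \<otimes>\<^sub>m \<iota> \<I>)"
    using e_natural[OF h] by (simp add: interchange del: tensor_arr_unit_right)
  also have "\<dots> \<Zsemi> u (A' \<otimes>\<^sub>o B') = (bangm h \<otimes>\<^sub>m e B) \<Zsemi> ((\<iota> (bang A') \<otimes>\<^sub>m u B') \<Zsemi> m A' B')"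
    by (simp add: u_m_right assoc)
  also have "\<dots> = (bangm h \<otimes>\<^sub>m convolution_unit B B') \<Zsemi> m A' B'"
    by (simp add: interchange convolution_unit_def flip: assoc)
  finally show ?thesis .
qed

text \<open>
  The hypothesis says that \<open>F\<close> commutes with scaling by elements of \<open>!\<I>\<close>. Scaling by \<open>\<eta> \<I>\<close> is the
  idempotent \<open>\<epsilon> \<Zsemi> \<eta>\<close>, which projects onto the linear part; hence \<open>F\<close> preserves linear parts.
\<close>
lemma linear_if_m_invariant:
  assumes [simp]: "A \<in> obj C" "B \<in> obj C" and F: "F \<in> homset C (bang A) (bang B)"
    and inv: "m \<I> A \<Zsemi> F = (\<iota> (bang \<I>) \<otimes>\<^sub>m F) \<Zsemi> m \<I> B"
  shows "F \<Zsemi> \<epsilon> B = \<epsilon> A \<Zsemi> linearization A B F"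
proof -
  note [simp] = F[unfolded homset_iff]
  \<comment> \<open>The pre-codereliction axiom with first object \<open>\<I>\<close>, where strictness hides the unitors.\<close>
  have scale: "\<epsilon> D \<Zsemi> \<eta> D = (\<eta> \<I> \<otimes>\<^sub>m \<iota> (bang D)) \<Zsemi> m \<I> D" if "D \<in> obj C" for D
    using \<eta>_m_left[of \<I> D] that by simp
  have "\<epsilon> A \<Zsemi> \<eta> A \<Zsemi> F = (\<eta> \<I> \<otimes>\<^sub>m \<iota> (bang A)) \<Zsemi> (m \<I> A \<Zsemi> F)"
    by (simp add: scale assoc)
  also have "\<dots> = ((\<eta> \<I> \<otimes>\<^sub>m \<iota> (bang A)) \<Zsemi> (\<iota> (bang \<I>) \<otimes>\<^sub>m F)) \<Zsemi> m \<I> B"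
    by (simp add: inv assoc)
  also have "\<dots> = ((\<iota> \<I> \<otimes>\<^sub>m F) \<Zsemi> (\<eta> \<I> \<otimes>\<^sub>m \<iota> (bang B))) \<Zsemi> m \<I> B"
    by (simp add: interchange del: tensor_arr_unit_left)
  also have "\<dots> = F \<Zsemi> (\<epsilon> B \<Zsemi> \<eta> B)"
    by (simp add: scale assoc)
  finally have "\<epsilon> A \<Zsemi> \<eta> A \<Zsemi> F \<Zsemi> \<epsilon> B = F \<Zsemi> \<epsilon> B \<Zsemi> (\<eta> B \<Zsemi> \<epsilon> B)"
    by (simp add: assoc)
  then show ?thesis
    by (simp add: linearization_def \<eta>_\<epsilon> assoc)
qed

text \<open>
  A coalgebra morphism between cofree coalgebras is recovered from its composite with \<open>\<epsilon>\<close> as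
  \<open>\<delta> A \<Zsemi> !(F \<Zsemi> \<epsilon> B)\<close>. When that composite factors through \<open>\<epsilon> A\<close>, the counit law removes \<open>\<delta> A\<close>.
\<close>
lemma bang_linearization:
  assumes [simp]: "A \<in> obj C" "B \<in> obj C" and F: "F \<in> homset C (bang A) (bang B)"
    and coalg: "F \<Zsemi> \<delta> B = \<delta> A \<Zsemi> bangm F"
    and inv: "m \<I> A \<Zsemi> F = (\<iota> (bang \<I>) \<otimes>\<^sub>m F) \<Zsemi> m \<I> B"
  shows "bangm (linearization A B F) = F"
proof -
  note [simp] = F[unfolded homset_iff] linearization_hom[OF F assms(1,2), unfolded homset_iff]
  have "F = F \<Zsemi> (\<delta> B \<Zsemi> bangm (\<epsilon> B))"
    by (simp add: \<delta>_bangm_\<epsilon>)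
  also have "\<dots> = (F \<Zsemi> \<delta> B) \<Zsemi> bangm (\<epsilon> B)"
    by (simp add: assoc)
  also have "\<dots> = \<delta> A \<Zsemi> bangm (F \<Zsemi> \<epsilon> B)"
    unfolding coalg by (simp add: assoc bang_comp)
  also have "F \<Zsemi> \<epsilon> B = \<epsilon> A \<Zsemi> linearization A B F"
    by (rule linear_if_m_invariant) (use F inv in auto)
  also have "\<delta> A \<Zsemi> bangm \<dots> = (\<delta> A \<Zsemi> bangm (\<epsilon> A)) \<Zsemi> bangm (linearization A B F)"
    by (simp add: bang_comp assoc)
  also have "\<dots> = bangm (linearization A B F)"
    by (simp add: \<delta>_bangm_\<epsilon>)
  finally show ?thesis by (rule sym)
qed

lemma linearization_bang:
  assumes f: "f \<in> homset C A B"
  shows "linearization A B (bangm f) = f"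
proof -
  note [simp] = f[unfolded homset_iff] homset_obj[OF f]
  show ?thesis
    by (simp add: linearization_def \<eta>_natural[OF f, symmetric] assoc \<eta>_\<epsilon>)
qed

text \<open>
  Linearization uses \<open>\<eta>\<close> at \<open>A \<otimes> B\<close>. Both \<open>\<eta>\<close> and \<open>\<epsilon>\<close> are compatible with \<open>m\<close>, so a property of \<open>m\<close>
  becomes one of \<open>\<otimes>\<close>.
\<close>
lemma linearization_tensor:
  assumes h: "h \<in> homset C A A'" and [simp]: "B \<in> obj C" "B' \<in> obj C"
    and F: "F \<in> homset C (bang B) (bang B')"
    and G: "G \<in> homset C (bang (A \<otimes>\<^sub>o B)) (bang (A' \<otimes>\<^sub>o B'))"
    and m: "m A B \<Zsemi> G = (bangm h \<otimes>\<^sub>m F) \<Zsemi> m A' B'"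
  shows "linearization (A \<otimes>\<^sub>o B) (A' \<otimes>\<^sub>o B') G = h \<otimes>\<^sub>m linearization B B' F"
proof -
  note [simp] = h[unfolded homset_iff] homset_obj[OF h] F[unfolded homset_iff] G[unfolded homset_iff]
  \<comment> \<open>Moving \<open>\<eta> A\<close> past \<open>m\<close> leaves \<open>\<epsilon> B\<close> on the other factor, where it cancels \<open>\<eta> B\<close>.\<close>
  have "(\<eta> A \<otimes>\<^sub>m \<eta> B) \<Zsemi> m A B = (\<iota> A \<otimes>\<^sub>m \<eta> B) \<Zsemi> ((\<eta> A \<otimes>\<^sub>m \<iota> (bang B)) \<Zsemi> m A B)"
    by (simp add: interchange flip: assoc)
  also have "\<dots> = (\<iota> A \<otimes>\<^sub>m (\<eta> B \<Zsemi> \<epsilon> B)) \<Zsemi> \<eta> (A \<otimes>\<^sub>o B)"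
    by (simp add: \<eta>_m_left interchange flip: assoc)
  also have "\<dots> = \<eta> (A \<otimes>\<^sub>o B)"
    by (simp add: \<eta>_\<epsilon>)
  finally have \<eta>: "\<eta> (A \<otimes>\<^sub>o B) = (\<eta> A \<otimes>\<^sub>m \<eta> B) \<Zsemi> m A B" ..
  have "linearization (A \<otimes>\<^sub>o B) (A' \<otimes>\<^sub>o B') G = (\<eta> A \<otimes>\<^sub>m \<eta> B) \<Zsemi> (m A B \<Zsemi> G) \<Zsemi> \<epsilon> (A' \<otimes>\<^sub>o B')"
    by (simp add: linearization_def \<eta> assoc)
  also have "\<dots> = (\<eta> A \<otimes>\<^sub>m \<eta> B) \<Zsemi> (bangm h \<otimes>\<^sub>m F) \<Zsemi> (\<epsilon> A' \<otimes>\<^sub>m \<epsilon> B')"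
    by (simp add: m m_\<epsilon> assoc)
  also have "\<dots> = linearization A A' (bangm h) \<otimes>\<^sub>m linearization B B' F"
    by (simp add: interchange linearization_def)
  finally show ?thesis
    by (simp add: linearization_bang[OF h])
qed

section \<open>The additive structure\<close>

text \<open>
  These are the literal formulas for the sum and the zero map, with every composite associated to
  the left. On arguments outside the homset the associativity law is unavailable, so their forms as
  linearizations hold only for typed arguments.
\<close>
definition plus where
  "plus A B f g = \<eta> A \<Zsemi> \<Delta> A \<Zsemi> (bangm f \<otimes>\<^sub>m bangm g) \<Zsemi> \<nabla> B \<Zsemi> \<epsilon> B"

definition zero where
  "zero A B = \<eta> A \<Zsemi> e A \<Zsemi> u B \<Zsemi> \<epsilon> B"

lemma plus_linearization:
  assumes "f \<in> homset C A B" "g \<in> homset C A B"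
  shows "plus A B f g = linearization A B (convolution A B (bangm f) (bangm g))"
  using assms homset_obj[OF assms(1)]
  by (simp add: plus_def linearization_def convolution_def assoc homset_iff)

lemma zero_linearization:
  assumes "A \<in> obj C" "B \<in> obj C"
  shows "zero A B = linearization A B (convolution_unit A B)"
  using assms by (simp add: zero_def linearization_def convolution_unit_def assoc)

lemma plus_hom:
  assumes f: "f \<in> homset C A B" and g: "g \<in> homset C A B"
  shows "plus A B f g \<in> homset C A B"
  unfolding plus_linearization[OF f g] using homset_obj[OF f] bangm_hom f g
  by (intro linearization_hom convolution_hom)

lemma zero_hom: "A \<in> obj C \<Longrightarrow> B \<in> obj C \<Longrightarrow> zero A B \<in> homset C A B"
  by (simp add: zero_linearization linearization_hom convolution_unit_hom)

text \<open>
  The functor \<open>!\<close> turns sums into convolutions, which transfers the monoid laws from convolution to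
  the sum. Linearity comes from \<open>m_bang_convolution\<close> at \<open>\<I>\<close> and \<open>\<iota> \<I>\<close>.
\<close>
lemma bang_plus:
  assumes f: "f \<in> homset C A B" and g: "g \<in> homset C A B"
  shows "bangm (plus A B f g) = convolution A B (bangm f) (bangm g)"
proof -
  note [simp] = homset_obj[OF f] f[unfolded homset_iff] g[unfolded homset_iff]
  show ?thesis
    unfolding plus_linearization[OF f g]
  proof (rule bang_linearization)
    show "convolution A B (bangm f) (bangm g) \<in> homset C (bang A) (bang B)"
      using bangm_hom f g by (intro convolution_hom) auto
    show "convolution A B (bangm f) (bangm g) \<Zsemi> \<delta> B = \<delta> A \<Zsemi> bangm (convolution A B (bangm f) (bangm g))"
      using f g by (rule bang_convolution_\<delta>)
    show "m \<I> A \<Zsemi> convolution A B (bangm f) (bangm g)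
      = (\<iota> (bang \<I>) \<otimes>\<^sub>m convolution A B (bangm f) (bangm g)) \<Zsemi> m \<I> B"
      using m_bang_convolution[OF ident_hom[OF unit_obj] f g] by (simp add: bangm_ident)
  qed auto
qed

lemma bang_zero:
  assumes [simp]: "A \<in> obj C" "B \<in> obj C"
  shows "bangm (zero A B) = convolution_unit A B"
  unfolding zero_linearization[OF assms]
proof (rule bang_linearization)
  show "m \<I> A \<Zsemi> convolution_unit A B = (\<iota> (bang \<I>) \<otimes>\<^sub>m convolution_unit A B) \<Zsemi> m \<I> B"
    using m_convolution_unit[OF ident_hom[OF unit_obj], of A B] by (simp add: bangm_ident)
qed (auto intro: convolution_unit_hom convolution_unit_\<delta>)

lemma hom_comm_monoid:
  assumes [simp]: "A \<in> obj C" "B \<in> obj C"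
  shows "comm_monoid \<lparr>carrier = homset C A B, monoid.mult = plus A B, one = zero A B\<rparr>"
proof (rule comm_monoidI, simp_all)
  fix f g assume fg: "f \<in> homset C A B" "g \<in> homset C A B"
  then show "plus A B f g \<in> homset C A B" by (rule plus_hom)
  show "plus A B f g = plus A B g f"
    using fg convolution_comm[OF assms bangm_hom[OF fg(1)] bangm_hom[OF fg(2)]] by (simp add: plus_linearization)
  fix h assume h: "h \<in> homset C A B"
  show "plus A B (plus A B f g) h = plus A B f (plus A B g h)"
    using fg h by (simp add: plus_linearization[OF plus_hom] plus_linearization[OF _ plus_hom]
        bang_plus convolution_assoc bangm_hom)
next
  show "zero A B \<in> homset C A B" by (simp add: zero_hom)
next
  fix f assume f: "f \<in> homset C A B"
  show "plus A B (zero A B) f = f"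
    using f by (simp add: plus_linearization[OF zero_hom] bang_zero convolution_unit_left
        bangm_hom linearization_bang)
qed

lemma comp_plus:
  assumes f: "f \<in> homset C A B" and g: "g \<in> homset C B D" and h: "h \<in> homset C B D"
  shows "f \<Zsemi> plus B D g h = plus A D (f \<Zsemi> g) (f \<Zsemi> h)"
proof -
  note [simp] = f[unfolded homset_iff] g[unfolded homset_iff] h[unfolded homset_iff]
    homset_obj[OF f] homset_obj[OF g]
  have "f \<Zsemi> plus B D g h = (f \<Zsemi> \<eta> B) \<Zsemi> \<Delta> B \<Zsemi> (bangm g \<otimes>\<^sub>m bangm h) \<Zsemi> \<nabla> D \<Zsemi> \<epsilon> D"
    by (simp add: plus_def assoc)
  also have "\<dots> = \<eta> A \<Zsemi> (bangm f \<Zsemi> \<Delta> B) \<Zsemi> (bangm g \<otimes>\<^sub>m bangm h) \<Zsemi> \<nabla> D \<Zsemi> \<epsilon> D"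
    by (simp add: \<eta>_natural[OF f] assoc)
  also have "\<dots> = \<eta> A \<Zsemi> \<Delta> A \<Zsemi> ((bangm f \<otimes>\<^sub>m bangm f) \<Zsemi> (bangm g \<otimes>\<^sub>m bangm h)) \<Zsemi> \<nabla> D \<Zsemi> \<epsilon> D"
    by (simp add: \<Delta>_natural[OF f] assoc)
  also have "\<dots> = plus A D (f \<Zsemi> g) (f \<Zsemi> h)"
    by (simp add: interchange bang_comp plus_def assoc)
  finally show ?thesis .
qed

lemma plus_comp:
  assumes g: "g \<in> homset C A B" and h: "h \<in> homset C A B" and k: "k \<in> homset C B D"
  shows "plus A B g h \<Zsemi> k = plus A D (g \<Zsemi> k) (h \<Zsemi> k)"
proof -
  note [simp] = k[unfolded homset_iff] g[unfolded homset_iff] h[unfolded homset_iff]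
    homset_obj[OF k] homset_obj[OF g]
  have "plus A B g h \<Zsemi> k = \<eta> A \<Zsemi> \<Delta> A \<Zsemi> (bangm g \<otimes>\<^sub>m bangm h) \<Zsemi> \<nabla> B \<Zsemi> (\<epsilon> B \<Zsemi> k)"
    by (simp add: plus_def assoc)
  also have "\<dots> = \<eta> A \<Zsemi> \<Delta> A \<Zsemi> (bangm g \<otimes>\<^sub>m bangm h) \<Zsemi> (\<nabla> B \<Zsemi> bangm k) \<Zsemi> \<epsilon> D"
    by (simp add: \<epsilon>_natural[OF k, symmetric] assoc)
  also have "\<dots> = \<eta> A \<Zsemi> \<Delta> A \<Zsemi> ((bangm g \<otimes>\<^sub>m bangm h) \<Zsemi> (bangm k \<otimes>\<^sub>m bangm k)) \<Zsemi> \<nabla> D \<Zsemi> \<epsilon> D"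
    by (simp add: nabla_natural[OF k, symmetric] assoc)
  also have "\<dots> = plus A D (g \<Zsemi> k) (h \<Zsemi> k)"
    by (simp add: interchange bang_comp plus_def assoc)
  finally show ?thesis .
qed

lemma comp_zero:
  assumes f: "f \<in> homset C A B" and [simp]: "D \<in> obj C"
  shows "f \<Zsemi> zero B D = zero A D"
proof -
  note [simp] = f[unfolded homset_iff] homset_obj[OF f]
  have "f \<Zsemi> zero B D = (f \<Zsemi> \<eta> B) \<Zsemi> e B \<Zsemi> u D \<Zsemi> \<epsilon> D"
    by (simp add: zero_def assoc)
  also have "\<dots> = \<eta> A \<Zsemi> (bangm f \<Zsemi> e B) \<Zsemi> u D \<Zsemi> \<epsilon> D"
    by (simp add: \<eta>_natural[OF f] assoc)
  also have "\<dots> = zero A D"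
    by (simp add: e_natural[OF f] zero_def assoc)
  finally show ?thesis .
qed

lemma zero_comp:
  assumes [simp]: "A \<in> obj C" and k: "k \<in> homset C B D"
  shows "zero A B \<Zsemi> k = zero A D"
proof -
  note [simp] = k[unfolded homset_iff] homset_obj[OF k]
  have "zero A B \<Zsemi> k = \<eta> A \<Zsemi> e A \<Zsemi> u B \<Zsemi> (\<epsilon> B \<Zsemi> k)"
    by (simp add: zero_def assoc)
  also have "\<dots> = \<eta> A \<Zsemi> e A \<Zsemi> (u B \<Zsemi> bangm k) \<Zsemi> \<epsilon> D"
    by (simp add: \<epsilon>_natural[OF k, symmetric] assoc)
  also have "\<dots> = zero A D"
    by (simp add: u_natural[OF k] zero_def assoc)
  finally show ?thesis .
qed

lemma tensor_plus:
  assumes f: "f \<in> homset C A A'" and g: "g \<in> homset C B B'" and h: "h \<in> homset C B B'"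
  shows "f \<otimes>\<^sub>m plus B B' g h = plus (A \<otimes>\<^sub>o B) (A' \<otimes>\<^sub>o B') (f \<otimes>\<^sub>m g) (f \<otimes>\<^sub>m h)"
  unfolding plus_linearization[OF g h] plus_linearization[OF tensor_hom[OF f g] tensor_hom[OF f h]]
  using homset_obj[OF f] homset_obj[OF g] bangm_hom tensor_hom f g h
  by (intro linearization_tensor[symmetric] m_bang_convolution convolution_hom) auto

lemma tensor_zero:
  assumes f: "f \<in> homset C A A'" and "B \<in> obj C" "B' \<in> obj C"
  shows "f \<otimes>\<^sub>m zero B B' = zero (A \<otimes>\<^sub>o B) (A' \<otimes>\<^sub>o B')"
proof -
  note [simp] = assms(2,3) homset_obj[OF f]
  have "linearization (A \<otimes>\<^sub>o B) (A' \<otimes>\<^sub>o B') (convolution_unit (A \<otimes>\<^sub>o B) (A' \<otimes>\<^sub>o B'))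
    = f \<otimes>\<^sub>m linearization B B' (convolution_unit B B')"
    using f by (intro linearization_tensor m_convolution_unit convolution_unit_hom) auto
  then show ?thesis
    by (simp add: zero_linearization)
qed

text \<open>
  Conjugating with the symmetry exchanges the two factors, and composition with it preserves sums.
\<close>
lemma plus_tensor:
  assumes g: "g \<in> homset C A A'" and h: "h \<in> homset C A A'" and k: "k \<in> homset C B B'"
  shows "plus A A' g h \<otimes>\<^sub>m k = plus (A \<otimes>\<^sub>o B) (A' \<otimes>\<^sub>o B') (g \<otimes>\<^sub>m k) (h \<otimes>\<^sub>m k)"
proof -
  note [simp] = homset_obj[OF g] homset_obj[OF k]
  note kg = tensor_hom[OF k g] and kh = tensor_hom[OF k h]
  have "plus A A' g h \<otimes>\<^sub>m k = \<sigma> A B \<Zsemi> (k \<otimes>\<^sub>m plus A A' g h) \<Zsemi> \<sigma> B' A'"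
    using sym_conjugate[OF k plus_hom[OF g h]] by simp
  also have "\<dots> = \<sigma> A B \<Zsemi> plus (B \<otimes>\<^sub>o A) (B' \<otimes>\<^sub>o A') (k \<otimes>\<^sub>m g) (k \<otimes>\<^sub>m h) \<Zsemi> \<sigma> B' A'"
    by (simp add: tensor_plus[OF k g h])
  also have "\<dots> = plus (A \<otimes>\<^sub>o B) (A' \<otimes>\<^sub>o B')
      (\<sigma> A B \<Zsemi> (k \<otimes>\<^sub>m g) \<Zsemi> \<sigma> B' A') (\<sigma> A B \<Zsemi> (k \<otimes>\<^sub>m h) \<Zsemi> \<sigma> B' A')"
    using sym_hom[of A B] sym_hom[of B' A'] kg kh
    by (simp add: comp_plus[OF _ kg kh] plus_comp comp_hom)
  also have "\<dots> = plus (A \<otimes>\<^sub>o B) (A' \<otimes>\<^sub>o B') (g \<otimes>\<^sub>m k) (h \<otimes>\<^sub>m k)"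
    by (simp add: sym_conjugate[OF k g] sym_conjugate[OF k h])
  finally show ?thesis .
qed

lemma zero_tensor:
  assumes [simp]: "A \<in> obj C" "A' \<in> obj C" and k: "k \<in> homset C B B'"
  shows "zero A A' \<otimes>\<^sub>m k = zero (A \<otimes>\<^sub>o B) (A' \<otimes>\<^sub>o B')"
proof -
  note [simp] = homset_obj[OF k]
  have "zero A A' \<otimes>\<^sub>m k = \<sigma> A B \<Zsemi> (k \<otimes>\<^sub>m zero A A') \<Zsemi> \<sigma> B' A'"
    using sym_conjugate[OF k zero_hom] by simp
  also have "\<dots> = \<sigma> A B \<Zsemi> zero (B \<otimes>\<^sub>o A) (B' \<otimes>\<^sub>o A') \<Zsemi> \<sigma> B' A'"
    by (simp add: tensor_zero[OF k])
  also have "\<dots> = zero (A \<otimes>\<^sub>o B) (A' \<otimes>\<^sub>o B')"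
    using comp_zero[OF sym_hom[of A B]] zero_comp[OF _ sym_hom[of B' A']] by simp
  finally show ?thesis .
qed

lemma additive: "additive_symmetric_monoidal_category C plus zero"
  by (intro additive_symmetric_monoidal_category.intro additive_symmetric_monoidal_category_axioms.intro
      additive_category.intro additive_category_axioms.intro
      strict_symmetric_monoidal_category_axioms category_axioms)
    (fact hom_comm_monoid comp_plus comp_zero plus_comp zero_comp
      tensor_plus tensor_zero plus_tensor zero_tensor)+

end

theorem theorem5p1:
  fixes C :: "('o, 'm, 'x) smc_scheme" (structure)
    and bang :: "'o \<Rightarrow> 'o" and bangm :: "'m \<Rightarrow> 'm"
    and \<delta> \<epsilon> \<Delta> e :: "'o \<Rightarrow> 'm"
    and m :: "'o \<Rightarrow> 'o \<Rightarrow> 'm" and mI :: 'm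
    and nabla :: "'o \<Rightarrow> 'm" ("\<nabla>") and u :: "'o \<Rightarrow> 'm"
    and \<eta> :: "'o \<Rightarrow> 'm"
  assumes "strict_symmetric_monoidal_category C"
    and "monoidal_bialgebra_modality C bang bangm \<delta> \<epsilon> \<Delta> e m mI \<nabla> u"
    and "pre_codereliction C bang bangm \<delta> \<epsilon> \<Delta> e m mI \<eta>"
  shows "additive_symmetric_monoidal_category C
    (\<lambda>A B f g. \<eta> A \<Zsemi> \<Delta> A \<Zsemi> (bangm f \<otimes>\<^sub>m bangm g) \<Zsemi> \<nabla> B \<Zsemi> \<epsilon> B)
    (\<lambda>A B. \<eta> A \<Zsemi> e A \<Zsemi> u B \<Zsemi> \<epsilon> B)"
proof -
  interpret monoidal_bialgebra_modality C bang bangm \<delta> \<epsilon> \<Delta> e m mI nabla u by fact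
  interpret pre_codereliction C bang bangm \<delta> \<epsilon> \<Delta> e m mI \<eta> by fact
  interpret pre_codereliction_bialgebra_modality C bang bangm \<delta> \<epsilon> \<Delta> e m mI nabla u \<eta> ..
  show ?thesis
    using additive unfolding plus_def[abs_def] zero_def[abs_def] .
qed

end
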